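(* Let $G$ be a group and let $\mathcal{F}$ be a generating family on $G$. Define \[ \mathcal{E}_{\mathcal{F}}=\{E\subset G\times G : \text{there exists } A\in\mathcal{F}\text{ such that } E\subset G(A\times A)\}. \] Then $\mathcal{E}_{\mathcal{F}}$ is a compatible coarse structure on $G$.
   Context: For subsets $A,B$ of $G$: $AB=\{ab : a\in A, b\in B\}$, $A^{-1}=\{a^{-1} : a\in A\}$. For $E\subset G\times G$, $GE=\{(ga,gb) : g\in G,\ (a,b)\in E\}$; $E$ is $G$-invariant if $GE=E$. A generating family on $G$ is a family $\mathcal{F}$ of subsets of $G$ such that: (a) some $A\in\mathcal{F}$ is non-empty; (b) a finite union of elements of $\mathcal{F}$ is in $\mathcal{F}$; (c) if $A,B\in\mathcal{F}$ then $AB\in\mathcal{F}$; (d) if $A\in\mathcal{F}$ then $A^{-1}\in\mathcal{F}$. A coarse structure on a set $X$ is a collection $\mathcal{E}$ of subsets of $X\times X$ (entourages) such that: the diagonal is an entourage; subsets of entourages are entourages; finite unions of entourages are entourages; the inverse $E^{-1}=\{(y,x) : (x,y)\in E\}$ of an entourage is an entourage; and the composition $E_1\circ E_2=\{(x,z) : \exists y\in X,\ (x,y)\in E_1\text{ and }(y,z)\in E_2\}$ of two entourages is an entourage. A coarse structure on a group $G$ is compatible if every entourage is contained in a $G$-invariant entourage. *)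

theory Defs
  imports "HOL-Algebra.Coset"
begin

text \<open>Usually written \<open>GE\<close>.\<close>

definition translates :: "('a, 'b) monoid_scheme \<Rightarrow> ('a \<times> 'a) set \<Rightarrow> ('a \<times> 'a) set" where
  "translates G E = {(g \<otimes>\<^bsub>G\<^esub> a, g \<otimes>\<^bsub>G\<^esub> b) | g a b. g \<in> carrier G \<and> (a, b) \<in> E}"

definition G_invariant :: "('a, 'b) monoid_scheme \<Rightarrow> ('a \<times> 'a) set \<Rightarrow> bool" where
  "G_invariant G E \<longleftrightarrow> translates G E = E"

text \<open>
  In both definitions below a finite union is a union of a non-empty finite subfamily. In
  particular a generating family need not contain the empty set. For a coarse structure the empty
  union is an entourage anyway, being a subset of the diagonal.
\<close>

definition generating_family :: "('a, 'b) monoid_scheme \<Rightarrow> 'a set set \<Rightarrow> bool" where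
  "generating_family G \<F> \<longleftrightarrow>
     \<F> \<subseteq> Pow (carrier G) \<and>
     (\<exists>A\<in>\<F>. A \<noteq> {}) \<and>
     (\<forall>\<A>. finite \<A> \<and> \<A> \<noteq> {} \<and> \<A> \<subseteq> \<F> \<longrightarrow> \<Union>\<A> \<in> \<F>) \<and>
     (\<forall>A\<in>\<F>. \<forall>B\<in>\<F>. A <#>\<^bsub>G\<^esub> B \<in> \<F>) \<and>
     (\<forall>A\<in>\<F>. set_inv\<^bsub>G\<^esub> A \<in> \<F>)"

definition coarse_structure :: "'a set \<Rightarrow> ('a \<times> 'a) set set \<Rightarrow> bool" where
  "coarse_structure X \<E> \<longleftrightarrow>
     \<E> \<subseteq> Pow (X \<times> X) \<and>
     Id_on X \<in> \<E> \<and>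
     (\<forall>E\<in>\<E>. \<forall>E'. E' \<subseteq> E \<longrightarrow> E' \<in> \<E>) \<and>
     (\<forall>\<S>. finite \<S> \<and> \<S> \<noteq> {} \<and> \<S> \<subseteq> \<E> \<longrightarrow> \<Union>\<S> \<in> \<E>) \<and>
     (\<forall>E\<in>\<E>. E\<inverse> \<in> \<E>) \<and>
     (\<forall>E\<^sub>1\<in>\<E>. \<forall>E\<^sub>2\<in>\<E>. E\<^sub>1 O E\<^sub>2 \<in> \<E>)"

definition compatible_coarse_structure ::
    "('a, 'b) monoid_scheme \<Rightarrow> ('a \<times> 'a) set set \<Rightarrow> bool" where
  "compatible_coarse_structure G \<E> \<longleftrightarrow>
     coarse_structure (carrier G) \<E> \<and>
     (\<forall>E\<in>\<E>. \<exists>E'\<in>\<E>. G_invariant G E' \<and> E \<subseteq> E')"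

definition family_entourages ::
    "('a, 'b) monoid_scheme \<Rightarrow> 'a set set \<Rightarrow> ('a \<times> 'a) set set" where
  "family_entourages G \<F> =
     {E. E \<subseteq> carrier G \<times> carrier G \<and> (\<exists>A\<in>\<F>. E \<subseteq> translates G (A \<times> A))}"

end

theory Submission
  imports Defs
begin

text \<open>
  Only the composition axiom needs an idea: if \<open>(ga, gb)\<close> and \<open>(hc, hd)\<close> satisfy \<open>gb = hc\<close>, then
  \<open>h = g b c\<^sup>-\<^sup>1\<close>, so the composite pair \<open>(ga, hd)\<close> is the \<open>g\<close>-translate of \<open>(a, b c\<^sup>-\<^sup>1 d)\<close>.
\<close>

lemma translates_mono: "E \<subseteq> E' \<Longrightarrow> translates G E \<subseteq> translates G E'"
  unfolding translates_def by blast

lemma translates_converse: "(translates G E)\<inverse> = translates G (E\<inverse>)"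
  unfolding translates_def by blast

context group
begin

lemma translates_subset_carrier:
  assumes "E \<subseteq> carrier G \<times> carrier G"
  shows "translates G E \<subseteq> carrier G \<times> carrier G"
  using assms unfolding translates_def by auto

text \<open>Translating by \<open>g\<close> and then by \<open>h\<close> is translating by
  \<open>h \<otimes> g\<close>, which gives one inclusion; translating by the identity gives the
  other. With \<open>E\<close> inside the carrier, associativity and the unit law apply to its
  coordinates.\<close>

lemma G_invariant_translates:
  assumes "E \<subseteq> carrier G \<times> carrier G"
  shows "G_invariant G (translates G E)"
  unfolding G_invariant_def
proof
  show "translates G (translates G E) \<subseteq> translates G E"
  proof
    fix p assume "p \<in> translates G (translates G E)"
    then obtain h g a b where p: "p = (h \<otimes> (g \<otimes> a), h \<otimes> (g \<otimes> b))"
      and g: "h \<in> carrier G" "g \<in> carrier G" and ab: "(a, b) \<in> E"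
      unfolding translates_def by blast
    have "a \<in> carrier G" "b \<in> carrier G"
      using assms ab by auto
    with p g have "p = ((h \<otimes> g) \<otimes> a, (h \<otimes> g) \<otimes> b)"
      by (simp add: m_assoc)
    with g ab show "p \<in> translates G E"
      unfolding translates_def by blast
  qed
next
  show "translates G E \<subseteq> translates G (translates G E)"
  proof
    fix p assume p: "p \<in> translates G E"
    then have "fst p \<in> carrier G" "snd p \<in> carrier G"
      using translates_subset_carrier[OF assms] by auto
    \<comment> \<open>The pair \<open>p\<close> already lies in \<open>translates G E\<close>, so it
      serves as its own witness, moved by \<open>\<one>\<close>.\<close>
    then have "p = (\<one> \<otimes> fst p, \<one> \<otimes> snd p)"
      by simp
    with p show "p \<in> translates G (translates G E)"
      unfolding translates_def[of G "translates G E"] by fastforce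
  qed
qed

text \<open>A single point \<open>a\<close> of \<open>A\<close> suffices: the translation by
  \<open>x \<otimes> inv a\<close> carries \<open>(a, a)\<close> to \<open>(x, x)\<close>. This is
  what the non-empty member of a generating family is for.\<close>

lemma Id_on_subset_translates:
  assumes "A \<subseteq> carrier G" "A \<noteq> {}"
  shows "Id_on (carrier G) \<subseteq> translates G (A \<times> A)"
proof
  fix p assume "p \<in> Id_on (carrier G)"
  then obtain x where x: "x \<in> carrier G" "p = (x, x)"
    by blast
  obtain a where a: "a \<in> A" "a \<in> carrier G"
    using assms by blast
  have "p = ((x \<otimes> inv a) \<otimes> a, (x \<otimes> inv a) \<otimes> a)"
    using x a by (simp add: m_assoc)
  moreover have "x \<otimes> inv a \<in> carrier G"
    using x a by simp
  ultimately show "p \<in> translates G (A \<times> A)"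
    using a unfolding translates_def by blast
qed

text \<open>One set \<open>C\<close> must contain both coordinates of the pair that \<open>g\<close>
  translates: \<open>A\<close> supplies \<open>a\<close>, and the triple product supplies
  \<open>b \<otimes> (inv c \<otimes> d)\<close>. Only products, inverses and a union occur in
  \<open>C\<close>, so a generating family containing \<open>A\<close> and \<open>B\<close> also
  contains \<open>C\<close>.\<close>

lemma translates_relcomp_subset:
  assumes A: "A \<subseteq> carrier G" and B: "B \<subseteq> carrier G"
  defines "C \<equiv> A \<union> (A <#> (set_inv B <#> B))"
  shows "translates G (A \<times> A) O translates G (B \<times> B) \<subseteq> translates G (C \<times> C)"
proof
  fix p assume "p \<in> translates G (A \<times> A) O translates G (B \<times> B)"
  then obtain g a b h c d where p: "p = (g \<otimes> a, h \<otimes> d)" and eq: "g \<otimes> b = h \<otimes> c"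
    and g: "g \<in> carrier G" "h \<in> carrier G"
    and mem: "a \<in> A" "b \<in> A" "c \<in> B" "d \<in> B"
    unfolding translates_def by blast
  have car: "a \<in> carrier G" "b \<in> carrier G" "c \<in> carrier G" "d \<in> carrier G"
    using mem A B by auto
  \<comment> \<open>Inserting \<open>c \<otimes> inv c\<close> prepares for \<open>eq\<close>, which
    replaces \<open>h \<otimes> c\<close> by \<open>g \<otimes> b\<close> and so expresses
    \<open>h\<close> through \<open>g\<close>.\<close>
  have "h = h \<otimes> c \<otimes> inv c"
    using g car by (simp add: m_assoc)
  then have "h = g \<otimes> b \<otimes> inv c"
    using eq by simp
  then have "h \<otimes> d = g \<otimes> (b \<otimes> (inv c \<otimes> d))"
    using g car by (simp add: m_assoc)
  moreover have "b \<otimes> (inv c \<otimes> d) \<in> C"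
    using mem unfolding C_def set_mult_def SET_INV_def by blast
  moreover have "a \<in> C"
    using mem unfolding C_def by blast
  ultimately show "p \<in> translates G (C \<times> C)"
    using p g unfolding translates_def by blast
qed

text \<open>Choose a member \<open>f E\<close> of the family for each entourage \<open>E\<close>;
  the union of these finitely many sets controls all the entourages at once, since
  \<open>translates\<close> is monotone.\<close>

lemma Union_mem_family_entourages:
  assumes F: "generating_family G \<F>"
    and S: "finite \<S>" "\<S> \<noteq> {}" "\<S> \<subseteq> family_entourages G \<F>"
  shows "\<Union>\<S> \<in> family_entourages G \<F>"
proof -
  have "\<forall>E\<in>\<S>. \<exists>A. A \<in> \<F> \<and> E \<subseteq> translates G (A \<times> A)"
    using S(3) unfolding family_entourages_def by blast
  then obtain f where f: "\<And>E. E \<in> \<S> \<Longrightarrow> f E \<in> \<F> \<and> E \<subseteq> translates G (f E \<times> f E)"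
    by metis
  have "finite (f ` \<S>) \<and> f ` \<S> \<noteq> {} \<and> f ` \<S> \<subseteq> \<F>"
    using S f by blast
  then have mem: "\<Union>(f ` \<S>) \<in> \<F>"
    using F unfolding generating_family_def by blast
  have "E \<subseteq> translates G (\<Union>(f ` \<S>) \<times> \<Union>(f ` \<S>))" if "E \<in> \<S>" for E
  proof -
    have "f E \<times> f E \<subseteq> \<Union>(f ` \<S>) \<times> \<Union>(f ` \<S>)"
      using that by blast
    then show ?thesis
      using f[OF that] translates_mono by blast
  qed
  with mem S(3) show ?thesis
    unfolding family_entourages_def by blast
qed

lemma relcomp_mem_family_entourages:
  assumes F: "generating_family G \<F>"
    and E: "E \<in> family_entourages G \<F>" "E' \<in> family_entourages G \<F>"
  shows "E O E' \<in> family_entourages G \<F>"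
proof -
  obtain A B where A: "A \<in> \<F>" "E \<subseteq> translates G (A \<times> A)"
    and B: "B \<in> \<F>" "E' \<subseteq> translates G (B \<times> B)"
    using E unfolding family_entourages_def by blast
  let ?D = "A <#> (set_inv B <#> B)"
  let ?C = "A \<union> ?D"
  have "?D \<in> \<F>"
    using F A(1) B(1) unfolding generating_family_def by blast
  \<comment> \<open>The union axiom speaks of non-empty finite subfamilies, so the binary union
    \<open>?C\<close> is obtained from the family \<open>{A, ?D}\<close>.\<close>
  then have "finite {A, ?D} \<and> {A, ?D} \<noteq> {} \<and> {A, ?D} \<subseteq> \<F>"
    using A(1) by blast
  then have "\<Union>{A, ?D} \<in> \<F>"
    using F unfolding generating_family_def by blast
  then have C: "?C \<in> \<F>"
    by simp
  have "A \<subseteq> carrier G" "B \<subseteq> carrier G"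
    using F A(1) B(1) unfolding generating_family_def by auto
  then have "E O E' \<subseteq> translates G (?C \<times> ?C)"
    using translates_relcomp_subset relcomp_mono[OF A(2) B(2)] by blast
  moreover have "E O E' \<subseteq> carrier G \<times> carrier G"
    using E unfolding family_entourages_def by blast
  ultimately show ?thesis
    using C unfolding family_entourages_def by blast
qed

text \<open>The square \<open>A \<times> A\<close> is symmetric and \<open>translates\<close>
  commutes with converse, so the same \<open>A\<close> controls both \<open>E\<close> and its
  converse.\<close>

lemma converse_mem_family_entourages:
  assumes "E \<in> family_entourages G \<F>"
  shows "E\<inverse> \<in> family_entourages G \<F>"
proof -
  obtain A where A: "A \<in> \<F>" "E \<subseteq> translates G (A \<times> A)"
    using assms unfolding family_entourages_def by blast
  have "E\<inverse> \<subseteq> (translates G (A \<times> A))\<inverse>"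
    using A(2) by blast
  then have "E\<inverse> \<subseteq> translates G (A \<times> A)"
    by (simp add: translates_converse converse_Times)
  moreover have "E\<inverse> \<subseteq> carrier G \<times> carrier G"
    using assms unfolding family_entourages_def by blast
  ultimately show ?thesis
    using A(1) unfolding family_entourages_def by blast
qed

lemma coarse_structure_family_entourages:
  assumes F: "generating_family G \<F>"
  shows "coarse_structure (carrier G) (family_entourages G \<F>)"
  unfolding coarse_structure_def
proof (intro conjI ballI allI impI)
  have "\<exists>A\<in>\<F>. A \<noteq> {}" and "\<F> \<subseteq> Pow (carrier G)"
    using F by (simp_all add: generating_family_def)
  then obtain A where "A \<in> \<F>" "A \<noteq> {}" "A \<subseteq> carrier G"
    by blast
  then show "Id_on (carrier G) \<in> family_entourages G \<F>"
    using Id_on_subset_translates unfolding family_entourages_def by blast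
next
  fix E E' assume "E \<in> family_entourages G \<F>" "E' \<subseteq> E"
  then show "E' \<in> family_entourages G \<F>"
    unfolding family_entourages_def by blast
next
  show "family_entourages G \<F> \<subseteq> Pow (carrier G \<times> carrier G)"
    unfolding family_entourages_def by blast
qed (simp_all add: Union_mem_family_entourages[OF F] relcomp_mem_family_entourages[OF F]
       converse_mem_family_entourages)

end

theorem proposition2p4:
  fixes G :: "('a, 'b) monoid_scheme" and \<F> :: "'a set set"
  assumes "group G"
    and "generating_family G \<F>"
  shows "compatible_coarse_structure G (family_entourages G \<F>)"
  unfolding compatible_coarse_structure_def
proof (intro conjI ballI)
  interpret group G by fact
  show "coarse_structure (carrier G) (family_entourages G \<F>)"
    using assms(2) by (rule coarse_structure_family_entourages)
  fix E assume "E \<in> family_entourages G \<F>"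
  then obtain A where A: "A \<in> \<F>" "E \<subseteq> translates G (A \<times> A)"
    unfolding family_entourages_def by blast
  \<comment> \<open>The invariant entourage containing \<open>E\<close> is the controlling set
    \<open>translates G (A \<times> A)\<close> itself.\<close>
  have "A \<times> A \<subseteq> carrier G \<times> carrier G"
    using assms(2) A(1) unfolding generating_family_def by blast
  then have "G_invariant G (translates G (A \<times> A))"
    and "translates G (A \<times> A) \<in> family_entourages G \<F>"
    using G_invariant_translates translates_subset_carrier A(1)
    unfolding family_entourages_def by blast+
  with A(2) show "\<exists>E'\<in>family_entourages G \<F>. G_invariant G E' \<and> E \<subseteq> E'"
    by blast
qed

end
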